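(* Assume a nonlinear system $x^+ = f(x,u)$ with state $x\in X\subset\mathbb{R}^{n_x}$ and input $u\in U\subset\mathbb{R}^{n_u}$, and its linear predictor $z^+ = Az+Bv$, $\hat x = Cz$ with lifting functions $\Phi$ and $\Psi$ (as described in the context). Assume that both the system and the predictor have the symmetry $\Gamma^x$, that is, for all $\gamma^x\in\Gamma^x$, with $\gamma^v=\gamma^u=h(\gamma^x)$ and $\gamma^z=h'(\gamma^x)$, 1. $f(\gamma^x x,\gamma^u u)=\gamma^x f(x,u)$; 2. $A\gamma^z z + B\gamma^u v=\gamma^z(Az+Bv)$ and $C\gamma^z z=\gamma^x Cz$; and assume that the lifting functions are symmetric, that is, 3. $\gamma^z\Phi(x)=\Phi(\gamma^x x)$ and $\gamma^v\Psi(u)=\Psi(\gamma^u u)$. If $(\hat x_t)_{t=0}^\infty$ and $(\widehat{\gamma^x x_t})_{t=0}^\infty$ are the predictions of the symmetrical trajectories $(x_t)_{t=0}^\infty$ and $(\gamma^x x_t)_{t=0}^\infty$ respectively, then $(\widehat{\gamma^x x_t})_{t=0}^\infty$ is equal to the symmetrized $(\hat x_t)_{t=0}^\infty$, i.e. $$(\widehat{\gamma^x x_t})_{t=0}^\infty=(\gamma^x\hat x_t)_{t=0}^\infty,$$ achieving the same prediction error (for predicting $(\gamma^x x_t)_{t=0}^\infty$) as $(\hat x_t)_{t=0}^\infty$ achieves for predicting $(x_t)_{t=0}^\infty$.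
   Context: Predictor: $A\in\mathbb{R}^{n_z\times n_z}$, $B\in\mathbb{R}^{n_z\times n_u}$, $C\in\mathbb{R}^{n_x\times n_z}$; $\Phi$ maps states to lifted states in $\mathbb{R}^{n_z}$ and $\Psi$ maps inputs to lifted inputs in $\mathbb{R}^{n_u}$ (lifted and original inputs have the same dimension). Given an initial state $x_0$ and inputs $(u_t)_{t\ge0}$, the predictor sets $z_0=\Phi(x_0)$, $v_t=\Psi(u_t)$, $z_{t+1}=Az_t+Bv_t$, and the prediction of the state $x_t$ is $\hat x_t=Cz_t$. Symmetrical trajectories: $(x_t)_{t=0}^\infty$ is the trajectory of the nonlinear system from $x_0$ under inputs $(u_t)_{t=0}^\infty$, and $(\gamma^x x_t)_{t=0}^\infty$ is the one from $\gamma^x x_0$ under inputs $(\gamma^u u_t)_{t=0}^\infty$. The prediction $\widehat{\gamma^x x_t}$ is the predictor's output at time $t$ for the initial state $\gamma^x x_0$ and inputs $\gamma^u u_0,\gamma^u u_1,\dots$. Symmetry groups: only sign symmetries are considered, so $\Gamma^x\subset \mathrm{GL}_{n_x}$, $\Gamma^u\subset\mathrm{GL}_{n_u}$ and $\Gamma^z\subset\mathrm{GL}_{n_z}$ are groups of diagonal matrices with diagonal entries $\pm1$, acting by matrix multiplication ($\mathrm{GL}_n$ is the group of invertible $n\times n$ matrices). $h:\Gamma^x\to\Gamma^u$ and $h':\Gamma^x\to\Gamma^z$ are group homomorphisms. The symmetry group of the lifted input equals that of the original input, $\Gamma^v=\Gamma^u$. Lifted-state symmetry: the output matrix has the block-diagonal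 form $C=\mathrm{bdiag}(c_1^\top,\dots,c_{n_x}^\top)$, where $c_i$ is a vector of length $|c_i|$ and $\sum_i|c_i|=n_z$. Writing $\gamma^x_i$ for the $i$-th diagonal entry of $\gamma^x$, $h'(\gamma^x)=\mathrm{bdiag}(\gamma^x_1 I_{|c_1|},\dots,\gamma^x_{n_x}I_{|c_{n_x}|})$ and $\Gamma^z=\{h'(\gamma^x):\gamma^x\in\Gamma^x\}$. Here $\mathrm{bdiag}$ denotes a block-diagonal matrix and $I_m$ the identity matrix of size $m$. *)

theory Defs
  imports Complex_Main "Jordan_Normal_Form.Matrix" "HOL-Algebra.Group"
begin

definition GL :: "nat \<Rightarrow> real mat monoid" where
  "GL n = units_of (ring_mat TYPE(real) n ())"

definition sign_symmetry_group :: "nat \<Rightarrow> real mat set \<Rightarrow> bool" where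
  "sign_symmetry_group n G \<longleftrightarrow>
     subgroup G (GL n) \<and>
     (\<forall>g\<in>G. diagonal_mat g \<and> (\<forall>i<n. g $$ (i, i) = 1 \<or> g $$ (i, i) = -1))"

definition symmetry_hom ::
    "nat \<Rightarrow> real mat set \<Rightarrow> nat \<Rightarrow> real mat set \<Rightarrow> (real mat \<Rightarrow> real mat) \<Rightarrow> bool" where
  "symmetry_hom m G n H \<phi> \<longleftrightarrow> \<phi> \<in> hom (GL m\<lparr>carrier := G\<rparr>) (GL n\<lparr>carrier := H\<rparr>)"

(* bdiag(c_1^T, ..., c_nx^T); the vectors are indexed from 0 *)
definition output_matrix :: "nat \<Rightarrow> (nat \<Rightarrow> real vec) \<Rightarrow> real mat" where
  "output_matrix nx c = diag_block_mat (map (\<lambda>i. mat_of_row (c i)) [0..<nx])"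

(* bdiag(g_1 I_{|c_1|}, ..., g_nx I_{|c_nx|}), where g_i is the i-th diagonal entry of g *)
definition lifted_symmetry :: "nat \<Rightarrow> (nat \<Rightarrow> real vec) \<Rightarrow> real mat \<Rightarrow> real mat" where
  "lifted_symmetry nx c g =
     diag_block_mat (map (\<lambda>i. g $$ (i, i) \<cdot>\<^sub>m 1\<^sub>m (dim_vec (c i))) [0..<nx])"

primrec trajectory ::
    "(real vec \<Rightarrow> real vec \<Rightarrow> real vec) \<Rightarrow> real vec \<Rightarrow> (nat \<Rightarrow> real vec) \<Rightarrow> nat \<Rightarrow> real vec" where
  "trajectory f x0 u 0 = x0"
| "trajectory f x0 u (Suc t) = f (trajectory f x0 u t) (u t)"

primrec lifted_trajectory ::
    "real mat \<Rightarrow> real mat \<Rightarrow> (real vec \<Rightarrow> real vec) \<Rightarrow> (real vec \<Rightarrow> real vec) \<Rightarrow>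
     real vec \<Rightarrow> (nat \<Rightarrow> real vec) \<Rightarrow> nat \<Rightarrow> real vec" where
  "lifted_trajectory A B \<Phi> \<Psi> x0 u 0 = \<Phi> x0"
| "lifted_trajectory A B \<Phi> \<Psi> x0 u (Suc t) =
     A *\<^sub>v lifted_trajectory A B \<Phi> \<Psi> x0 u t + B *\<^sub>v \<Psi> (u t)"

definition prediction ::
    "real mat \<Rightarrow> real mat \<Rightarrow> real mat \<Rightarrow> (real vec \<Rightarrow> real vec) \<Rightarrow> (real vec \<Rightarrow> real vec) \<Rightarrow>
     real vec \<Rightarrow> (nat \<Rightarrow> real vec) \<Rightarrow> nat \<Rightarrow> real vec" where
  "prediction A B C \<Phi> \<Psi> x0 u t = C *\<^sub>v lifted_trajectory A B \<Phi> \<Psi> x0 u t"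

(* Euclidean norm of the error at time t *)
definition prediction_error ::
    "(nat \<Rightarrow> real vec) \<Rightarrow> (nat \<Rightarrow> real vec) \<Rightarrow> nat \<Rightarrow> real" where
  "prediction_error x xhat t = sqrt ((x t - xhat t) \<bullet> (x t - xhat t))"

(* Absolute error of each component; every error measure that ignores the signs
   of the components (any p-norm, mean squared error, ...) is a function of it *)
definition componentwise_error ::
    "(nat \<Rightarrow> real vec) \<Rightarrow> (nat \<Rightarrow> real vec) \<Rightarrow> nat \<Rightarrow> real vec" where
  "componentwise_error x xhat t = map_vec abs (x t - xhat t)"

end

theory Submission
  imports Defs
begin

text \<open>Symmetry propagates along time by induction. The system symmetry carries the trajectory
  from \<open>x0\<close> to the one from its image under \<open>\<gamma>\<close>. The lifting
  symmetries and the predictor symmetry likewise turn the lifted trajectory into its image under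
  \<open>h' \<gamma>\<close>, and the output symmetry converts \<open>h' \<gamma>\<close> back into
  \<open>\<gamma>\<close>, so the predictions correspond. The error vector of the symmetrized pair
  is therefore \<open>\<gamma>\<close> times the original one. Since \<open>\<gamma>\<close> is
  diagonal with entries 1 or -1, it only flips signs of coordinates: the absolute values agree
  (\<open>sign_symmetry_map_vec_abs\<close>, \<open>componentwise_error_sign_symmetry\<close>), and
  hence so does the Euclidean error, which depends on them alone
  (\<open>prediction_error_componentwise\<close>).\<close>

lemma GL_carrier: "carrier (GL n) \<subseteq> carrier_mat n n"
  by (auto simp: GL_def units_of_def Units_def ring_mat_simps)

lemma sign_symmetry_group_carrier:
  assumes "sign_symmetry_group n G" "g \<in> G"
  shows "g \<in> carrier_mat n n"
  using assms GL_carrier subgroup.subset unfolding sign_symmetry_group_def by blast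

lemma sign_symmetry_abs_entry:
  assumes "sign_symmetry_group n G" "g \<in> G" "i < n"
  shows "\<bar>g $$ (i, i)\<bar> = 1"
  using assms unfolding sign_symmetry_group_def by fastforce

lemma diagonal_mat_mult_vec_index:
  fixes g :: "'a :: semiring_0 mat"
  assumes "g \<in> carrier_mat n n" "diagonal_mat g" "v \<in> carrier_vec n" "i < n"
  shows "(g *\<^sub>v v) $ i = g $$ (i, i) * v $ i"
proof -
  have "(g *\<^sub>v v) $ i = (\<Sum>j = 0..<n. g $$ (i, j) * v $ j)"
    using assms by (auto simp: scalar_prod_def intro!: sum.cong)
  also have "\<dots> = (\<Sum>j = 0..<n. if j = i then g $$ (i, i) * v $ i else 0)"
    using assms by (intro sum.cong) (auto simp: diagonal_mat_def)
  also have "\<dots> = g $$ (i, i) * v $ i"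
    using assms by simp
  finally show ?thesis .
qed

text \<open>Each coordinate is multiplied by a diagonal entry of absolute value 1. This is where the
  restriction to sign symmetries enters; a general invertible matrix would change the
  errors.\<close>

lemma sign_symmetry_map_vec_abs:
  assumes G: "sign_symmetry_group n G" "g \<in> G" and v: "v \<in> carrier_vec n"
  shows "map_vec abs (g *\<^sub>v v) = map_vec abs v"
proof -
  have g: "g \<in> carrier_mat n n" "diagonal_mat g"
    using G sign_symmetry_group_carrier by (auto simp: sign_symmetry_group_def)
  show ?thesis
    using g v sign_symmetry_abs_entry[OF G]
    \<comment> \<open>The default rule \<open>index_mult_mat_vec\<close> would expand the product
      into a scalar product of a row before the diagonal formula could apply.\<close>
    by (intro eq_vecI) (auto simp: diagonal_mat_mult_vec_index[OF g v] abs_mult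
          simp del: index_mult_mat_vec)
qed

lemma scalar_prod_self_map_vec_abs:
  "map_vec abs v \<bullet> map_vec abs v = v \<bullet> (v :: real vec)"
  by (simp add: scalar_prod_def)

text \<open>Squares do not see signs. Equality of componentwise errors thus transfers to the
  Euclidean error, and only the former has to be proved directly.\<close>

lemma prediction_error_componentwise:
  "prediction_error x y t = sqrt (componentwise_error x y t \<bullet> componentwise_error x y t)"
  by (simp add: prediction_error_def componentwise_error_def scalar_prod_self_map_vec_abs)

text \<open>By linearity \<open>g\<close> factors out of the difference, and absolute values then
  absorb it.\<close>

lemma componentwise_error_sign_symmetry:
  assumes G: "sign_symmetry_group n G" "g \<in> G"
    and "\<And>t. x t \<in> carrier_vec n" "\<And>t. y t \<in> carrier_vec n"
  shows "componentwise_error (\<lambda>t. g *\<^sub>v x t) (\<lambda>t. g *\<^sub>v y t) = componentwise_error x y"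
proof
  fix t
  have "g *\<^sub>v x t - g *\<^sub>v y t = g *\<^sub>v (x t - y t)"
    using mult_minus_distrib_mat_vec[OF sign_symmetry_group_carrier[OF G]] assms(3,4) by metis
  then show "componentwise_error (\<lambda>t. g *\<^sub>v x t) (\<lambda>t. g *\<^sub>v y t) t = componentwise_error x y t"
    using assms by (simp add: componentwise_error_def sign_symmetry_map_vec_abs[OF G])
qed

theorem corollary1:
  fixes nx nu nz :: nat
    and X U :: "real vec set"
    and f :: "real vec \<Rightarrow> real vec \<Rightarrow> real vec"
    and A B C :: "real mat"
    and c :: "nat \<Rightarrow> real vec"
    and \<Phi> \<Psi> :: "real vec \<Rightarrow> real vec"
    and \<Gamma>x \<Gamma>u \<Gamma>v \<Gamma>z :: "real mat set"
    and h h' :: "real mat \<Rightarrow> real mat"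
    and x0 :: "real vec"
    and u x xhat \<gamma>xhat :: "nat \<Rightarrow> real vec"
    and \<gamma> :: "real mat"
  assumes X: "X \<subseteq> carrier_vec nx"
    and U: "U \<subseteq> carrier_vec nu"
    and f: "\<And>x w. x \<in> X \<Longrightarrow> w \<in> U \<Longrightarrow> f x w \<in> carrier_vec nx"
    and A: "A \<in> carrier_mat nz nz"
    and B: "B \<in> carrier_mat nz nu"
    and C: "C \<in> carrier_mat nx nz"
    and \<Phi>: "\<And>x. x \<in> X \<Longrightarrow> \<Phi> x \<in> carrier_vec nz"
    and \<Psi>: "\<And>w. w \<in> U \<Longrightarrow> \<Psi> w \<in> carrier_vec nu"
    and \<Gamma>x: "sign_symmetry_group nx \<Gamma>x"
    and \<Gamma>u: "sign_symmetry_group nu \<Gamma>u"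
    and \<Gamma>z: "sign_symmetry_group nz \<Gamma>z"
    and h: "symmetry_hom nx \<Gamma>x nu \<Gamma>u h"
    and h': "symmetry_hom nx \<Gamma>x nz \<Gamma>z h'"
    and \<Gamma>v_eq: "\<Gamma>v = \<Gamma>u"
    and nz: "(\<Sum>i<nx. dim_vec (c i)) = nz"
    and C_blocks: "C = output_matrix nx c"
    and h'_blocks: "\<And>g. g \<in> \<Gamma>x \<Longrightarrow> h' g = lifted_symmetry nx c g"
    and \<Gamma>z_eq: "\<Gamma>z = h' ` \<Gamma>x"
    and system_symmetry:
      "\<And>g x w. g \<in> \<Gamma>x \<Longrightarrow> x \<in> X \<Longrightarrow> w \<in> U \<Longrightarrow> f (g *\<^sub>v x) (h g *\<^sub>v w) = g *\<^sub>v f x w"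
    and predictor_symmetry:
      "\<And>g z v. g \<in> \<Gamma>x \<Longrightarrow> z \<in> carrier_vec nz \<Longrightarrow> v \<in> carrier_vec nu \<Longrightarrow>
         A *\<^sub>v (h' g *\<^sub>v z) + B *\<^sub>v (h g *\<^sub>v v) = h' g *\<^sub>v (A *\<^sub>v z + B *\<^sub>v v)"
    and output_symmetry:
      "\<And>g z. g \<in> \<Gamma>x \<Longrightarrow> z \<in> carrier_vec nz \<Longrightarrow> C *\<^sub>v (h' g *\<^sub>v z) = g *\<^sub>v (C *\<^sub>v z)"
    and \<Phi>_symmetry: "\<And>g x. g \<in> \<Gamma>x \<Longrightarrow> x \<in> X \<Longrightarrow> h' g *\<^sub>v \<Phi> x = \<Phi> (g *\<^sub>v x)"
    and \<Psi>_symmetry: "\<And>g w. g \<in> \<Gamma>x \<Longrightarrow> w \<in> U \<Longrightarrow> h g *\<^sub>v \<Psi> w = \<Psi> (h g *\<^sub>v w)"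
    and states: "\<And>t. x t \<in> X"
    and inputs: "\<And>t. u t \<in> U"
    and \<gamma>: "\<gamma> \<in> \<Gamma>x"
    and x_def: "x = trajectory f x0 u"
    and xhat_def: "xhat = prediction A B C \<Phi> \<Psi> x0 u"
    and \<gamma>xhat_def: "\<gamma>xhat = prediction A B C \<Phi> \<Psi> (\<gamma> *\<^sub>v x0) (\<lambda>t. h \<gamma> *\<^sub>v u t)"
  shows "trajectory f (\<gamma> *\<^sub>v x0) (\<lambda>t. h \<gamma> *\<^sub>v u t) = (\<lambda>t. \<gamma> *\<^sub>v x t) \<and>
         \<gamma>xhat = (\<lambda>t. \<gamma> *\<^sub>v xhat t) \<and>
         prediction_error (\<lambda>t. \<gamma> *\<^sub>v x t) \<gamma>xhat = prediction_error x xhat \<and>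
         componentwise_error (\<lambda>t. \<gamma> *\<^sub>v x t) \<gamma>xhat = componentwise_error x xhat"
proof -
  \<comment> \<open>The initial state is the trajectory at time 0; membership in \<open>X\<close> is
    what the symmetry of \<open>\<Phi>\<close> asks for.\<close>
  have x0: "x0 \<in> X"
    using states[of 0] by (simp add: x_def)
  have traj: "trajectory f (\<gamma> *\<^sub>v x0) (\<lambda>t. h \<gamma> *\<^sub>v u t) t = \<gamma> *\<^sub>v x t" for t
  proof (induction t)
    case (Suc t)
    then show ?case
      using system_symmetry[OF \<gamma> states[of t] inputs[of t]] by (simp add: x_def)
  qed (simp add: x_def)
  let ?z = "lifted_trajectory A B \<Phi> \<Psi> x0 u"
  \<comment> \<open>The predictor and output symmetries are assumed only for vectors of the right
    dimension.\<close>
  have z: "?z t \<in> carrier_vec nz" for t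
  proof (induction t)
    case (Suc t)
    then show ?case
      using A B \<Psi>[OF inputs[of t]] by auto
  qed (simp add: \<Phi> x0)
  have lifted: "lifted_trajectory A B \<Phi> \<Psi> (\<gamma> *\<^sub>v x0) (\<lambda>t. h \<gamma> *\<^sub>v u t) t = h' \<gamma> *\<^sub>v ?z t" for t
  proof (induction t)
    case 0
    show ?case by (simp add: \<Phi>_symmetry[OF \<gamma> x0])
  next
    case (Suc t)
    then show ?case
      \<comment> \<open>The symmetry of \<open>\<Psi>\<close> first moves \<open>h \<gamma>\<close>
        outside the lifted input; the next lifted state then has exactly the form in the predictor
        symmetry.\<close>
      using predictor_symmetry[OF \<gamma> z[of t] \<Psi>[OF inputs[of t]]] \<Psi>_symmetry[OF \<gamma> inputs[of t]]
      by simp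
  qed
  have pred: "\<gamma>xhat = (\<lambda>t. \<gamma> *\<^sub>v xhat t)"
    by (rule ext) (simp add: \<gamma>xhat_def xhat_def prediction_def lifted output_symmetry[OF \<gamma> z])
  have "xhat t \<in> carrier_vec nx" for t
    using C z[of t] by (simp add: xhat_def prediction_def)
  then have err: "componentwise_error (\<lambda>t. \<gamma> *\<^sub>v x t) \<gamma>xhat = componentwise_error x xhat"
    \<comment> \<open>Rewriting with \<open>pred\<close> exhibits both sequences as images under the
      same \<open>\<gamma>\<close>.\<close>
    unfolding pred using states X by (intro componentwise_error_sign_symmetry[OF \<Gamma>x \<gamma>]) auto
  then have "prediction_error (\<lambda>t. \<gamma> *\<^sub>v x t) \<gamma>xhat = prediction_error x xhat"
    by (intro ext) (simp add: prediction_error_componentwise)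
  with traj pred err show ?thesis by blast
qed

end
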